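(* Let $G$ be a group, let $A$ and $B$ be finite subsets of $G$ with $A$ nonempty and $B$ normal in $G$, and suppose that $|AB|\leq K|A|$ for some positive real number $K$. Then there exists a nonempty subset $X$ of $A$ such that \[ |XB^m|\leq K^m|X|\qquad\text{for all } m=1,2,\dotsc. \] In particular, if $B$ is a finite normal subset of a group $G$ and $K$ is a positive real number with $|B^2|\leq K|B|$, then $|B^m|\leq K^m|B|$ for all $m=1,2,\dotsc$.
   Context: A subset $B$ of a group $G$ is normal in $G$ if $g^{-1}Bg=B$ for all $g\in G$, i.e. $B$ is a union of conjugacy classes. Products of subsets are $AB=\{ab : a\in A,\ b\in B\}$, and $B^m$ is the $m$-fold product set $BB\dotsb B$. *)

theory Defs
  imports Complex_Main "HOL-Algebra.Coset"
begin

definition normal_subset :: "('a, 'b) monoid_scheme \<Rightarrow> 'a set \<Rightarrow> bool"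
  where "normal_subset G B \<longleftrightarrow>
    B \<subseteq> carrier G \<and>
    (\<forall>g\<in>carrier G. (inv\<^bsub>G\<^esub> g <#\<^bsub>G\<^esub> B) #>\<^bsub>G\<^esub> g = B)"

primrec set_power :: "('a, 'b) monoid_scheme \<Rightarrow> 'a set \<Rightarrow> nat \<Rightarrow> 'a set"
  where
    "set_power G B 0 = {\<one>\<^bsub>G\<^esub>}"
  | "set_power G B (Suc m) = set_power G B m <#>\<^bsub>G\<^esub> B"

end

theory Submission
  imports Defs
begin

text \<open>
  This is Petridis's proof of Pluennecke's inequality. Choose a nonempty \<open>X \<subseteq> A\<close> minimising
  \<open>\<kappa> = |XB| / |X|\<close>. Adding the elements of \<open>C\<close> one at a time shows \<open>|CXB| \<le> \<kappa> |CX|\<close> for every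
  finite \<open>C\<close>. Since \<open>B\<close> is normal it commutes with \<open>X\<close>, so taking \<open>C = B\<^sup>m\<close> gives
  \<open>|XB\<^sup>m\<^sup>+\<^sup>1| = |B\<^sup>mXB| \<le> \<kappa> |B\<^sup>mX| = \<kappa> |XB\<^sup>m|\<close>.
\<close>

lemma finite_set_mult:
  assumes "finite H" "finite K"
  shows "finite (H <#>\<^bsub>G\<^esub> K)"
  using assms by (simp add: set_mult_def)

lemma set_mult_mono:
  assumes "H \<subseteq> H'" "K \<subseteq> K'"
  shows "H <#>\<^bsub>G\<^esub> K \<subseteq> H' <#>\<^bsub>G\<^esub> K'"
  using assms unfolding set_mult_def by blast

lemma set_mult_insert_left: "insert c C <#>\<^bsub>G\<^esub> H = (c <#\<^bsub>G\<^esub> H) \<union> (C <#>\<^bsub>G\<^esub> H)"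
  unfolding set_mult_def l_coset_def by blast

lemma (in group) card_l_coset:
  assumes "c \<in> carrier G" "H \<subseteq> carrier G"
  shows "card (c <# H) = card H"
proof -
  have "c <# H = (\<lambda>h. c \<otimes> h) ` H"
    by (auto simp: l_coset_def)
  moreover have "inj_on (\<lambda>h. c \<otimes> h) H"
    using assms by (intro inj_onI) (metis Units_eq Units_l_cancel subsetD)
  ultimately show ?thesis by (simp add: card_image)
qed

lemma (in group) l_coset_set_mult_assoc:
  assumes "c \<in> carrier G" "H \<subseteq> carrier G" "K \<subseteq> carrier G"
  shows "(c <# H) <#> K = c <# (H <#> K)"
  using set_mult_assoc[of "{c}" H K] assms by (simp add: l_coset_eq_set_mult)

text \<open>Any \<open>x\<close> in \<open>X\<close> puts the translate \<open>x <# H\<close>, of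
  the same size as \<open>H\<close>, inside the product. This later removes the unknown factor
  \<open>X\<close> from the bound on \<open>B^m\<close>.\<close>

lemma (in group) card_set_mult_ge_right:
  assumes "X \<subseteq> carrier G" "X \<noteq> {}" "finite X" "H \<subseteq> carrier G" "finite H"
  shows "card H \<le> card (X <#> H)"
proof -
  obtain x where "x \<in> X" using assms by blast
  then have "x <# H \<subseteq> X <#> H" "x \<in> carrier G"
    using assms by (auto simp: l_coset_def set_mult_def)
  then show ?thesis
    using card_mono[OF finite_set_mult[OF assms(3,5)]] card_l_coset assms(4) by metis
qed

lemma (in group) set_power_subset_carrier:
  assumes "B \<subseteq> carrier G"
  shows "set_power G B m \<subseteq> carrier G"
  using assms by (induction m) (simp_all add: set_mult_closed)

lemma (in group) finite_set_power:
  assumes "finite B"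
  shows "finite (set_power G B m)"
  using assms by (induction m) (simp_all add: finite_set_mult)

lemma (in group) set_mult_one_right:
  assumes "X \<subseteq> carrier G"
  shows "X <#> {\<one>} = X"
  using assms unfolding set_mult_def by force

lemma (in group) set_mult_one_left:
  assumes "X \<subseteq> carrier G"
  shows "{\<one>} <#> X = X"
  using assms unfolding set_mult_def by force

text \<open>Replace \<open>B\<close> by its conjugate under \<open>x\<close>; the factor
  \<open>x\<close> on the left then cancels \<open>inv x\<close>.\<close>

lemma (in group) normal_subset_coset_eq:
  assumes "normal_subset G B" "x \<in> carrier G"
  shows "x <# B = B #> x"
proof -
  have B: "B \<subseteq> carrier G" and eq: "(inv x <# B) #> x = B"
    using assms by (auto simp: normal_subset_def)
  have "x <# B = x <# ((inv x <# B) #> x)" using eq by simp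
  also have "\<dots> = (x <# (inv x <# B)) #> x"
    using coset_assoc[of x x "inv x <# B"] assms B by (simp add: l_coset_subset_G)
  also have "\<dots> = B #> x"
    using assms B by (simp add: lcos_m_assoc lcos_mult_one)
  finally show ?thesis .
qed

lemma (in group) normal_subset_set_mult_commute:
  assumes "normal_subset G B" "X \<subseteq> carrier G"
  shows "X <#> B = B <#> X"
proof -
  have "X <#> B = (\<Union>x\<in>X. x <# B)"
    unfolding set_mult_def l_coset_def by blast
  also have "\<dots> = (\<Union>x\<in>X. B #> x)"
    using normal_subset_coset_eq[OF assms(1)] assms(2) by blast
  also have "\<dots> = B <#> X"
    unfolding set_mult_def r_coset_def by blast
  finally show ?thesis .
qed

text \<open>One factor \<open>B\<close> at a time is moved past \<open>X\<close>. This is what lets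
  a power of \<open>B\<close> take the place of the left factor \<open>C\<close> in
  \<open>petridis\<close>.\<close>

lemma (in group) set_power_commute:
  assumes "normal_subset G B" "X \<subseteq> carrier G"
  shows "X <#> set_power G B m = set_power G B m <#> X"
proof (induction m)
  case 0
  then show ?case by (simp add: set_mult_one_left set_mult_one_right assms)
next
  case (Suc m)
  let ?P = "set_power G B m"
  have B: "B \<subseteq> carrier G" using assms by (simp add: normal_subset_def)
  note P = set_power_subset_carrier[OF B, of m]
  have "X <#> (?P <#> B) = (?P <#> X) <#> B"
    using set_mult_assoc[OF assms(2) P B] Suc by simp
  also have "\<dots> = ?P <#> (B <#> X)"
    using set_mult_assoc[OF P assms(2) B] normal_subset_set_mult_commute[OF assms] by simp
  also have "\<dots> = (?P <#> B) <#> X"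
    using set_mult_assoc[OF P B assms(2)] by simp
  finally show ?case by simp
qed

text \<open>When \<open>c\<close> joins \<open>C\<close>, the set \<open>CX\<close> gains all of
  \<open>cX\<close> except an overlap \<open>cZ\<close>, while \<open>CXB\<close> gains at most
  \<open>cXB\<close> without \<open>cZB\<close>. Minimality applied to \<open>Z\<close> says that
  the second saving is at least \<kappa> times the first. Stating minimality without quotients lets
  \<open>Z\<close> be empty.\<close>

lemma (in group) petridis:
  fixes \<kappa> :: real
  assumes X: "X \<subseteq> carrier G" "finite X" and B: "B \<subseteq> carrier G" "finite B"
    and eq: "real (card (X <#> B)) = \<kappa> * real (card X)"
    and minimal: "\<And>Z. Z \<subseteq> X \<Longrightarrow> \<kappa> * real (card Z) \<le> real (card (Z <#> B))"
    and "finite C" "C \<subseteq> carrier G"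
  shows "real (card (C <#> X <#> B)) \<le> \<kappa> * real (card (C <#> X))"
  using \<open>finite C\<close> \<open>C \<subseteq> carrier G\<close>
proof (induction C rule: finite_induct)
  case empty
  then show ?case by (simp add: set_mult_def)
next
  case (insert c C)
  then have c: "c \<in> carrier G" and C: "C \<subseteq> carrier G" by auto
  \<comment> \<open>The elements of \<open>X\<close> whose translate by \<open>c\<close> contributes
    nothing new to \<open>CX\<close>.\<close>
  define Z where "Z = {x \<in> X. c \<otimes> x \<in> C <#> X}"
  have ZX: "Z \<subseteq> X" and Z: "Z \<subseteq> carrier G"
    using X by (auto simp: Z_def)
  note CX = set_mult_closed[OF C X(1)]
  have fin: "finite (C <#> X)" "finite (C <#> X <#> B)" "finite (c <# X)"
      "finite (c <# (X <#> B))"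
    using insert.hyps X B by (simp_all add: finite_set_mult l_coset_eq_set_mult)
  have XB: "X <#> B \<subseteq> carrier G" "Z <#> B \<subseteq> carrier G"
    using X Z B by (simp_all add: set_mult_closed)
  have inter: "(c <# X) \<inter> (C <#> X) = c <# Z"
    by (auto simp: Z_def l_coset_def)
  \<comment> \<open>Only an inclusion: some \<open>cxb\<close> may lie in \<open>CXB\<close>
    although \<open>cx\<close> is not in \<open>CX\<close>. Hence the count for \<open>CX\<close>
    below is exact and the one for \<open>CXB\<close> is an upper bound.\<close>
  have sub: "c <# (Z <#> B) \<subseteq> (c <# (X <#> B)) \<inter> (C <#> X <#> B)"
  proof -
    have "(c <# Z) <#> B \<subseteq> (c <# X) <#> B \<and> (c <# Z) <#> B \<subseteq> C <#> X <#> B"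
      using inter by (intro conjI set_mult_mono) auto
    then show ?thesis by (simp add: l_coset_set_mult_assoc c X Z B)
  qed
  have "card ((c <# X) \<union> (C <#> X)) + card Z = card X + card (C <#> X)"
    using card_Un_Int[OF fin(3,1)] by (simp add: inter card_l_coset c X Z)
  then have card_CX: "real (card (insert c C <#> X))
      = real (card X) + real (card (C <#> X)) - real (card Z)"
    unfolding set_mult_insert_left by linarith
  have "insert c C <#> X <#> B = (c <# (X <#> B)) \<union> (C <#> X <#> B)"
    unfolding l_coset_set_mult_assoc[OF c X(1) B(1), symmetric] set_mult_insert_left
    by (auto simp: set_mult_def)
  moreover have "card ((c <# (X <#> B)) \<union> (C <#> X <#> B)) + card (Z <#> B)
      \<le> card (X <#> B) + card (C <#> X <#> B)"
    using card_Un_Int[OF fin(4,2)] card_mono[OF _ sub] fin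
    by (simp add: card_l_coset c XB)
  ultimately have "real (card (insert c C <#> X <#> B))
      \<le> real (card (X <#> B)) + real (card (C <#> X <#> B)) - real (card (Z <#> B))"
    by simp
  \<comment> \<open>The three terms are bounded by the equality for \<open>X\<close>, the induction
    hypothesis for \<open>C\<close> and, for the subtracted term, minimality at
    \<open>Z\<close>.\<close>
  also have "\<dots> \<le> \<kappa> * real (card X) + \<kappa> * real (card (C <#> X)) - \<kappa> * real (card Z)"
    using eq insert.IH[OF C] minimal[OF ZX] by linarith
  also have "\<dots> = \<kappa> * real (card (insert c C <#> X))"
    unfolding card_CX by (simp add: algebra_simps)
  finally show ?case .
qed

lemma (in group) pluennecke_normal_subset:
  fixes K :: real
  assumes A: "A \<subseteq> carrier G" "finite A" "A \<noteq> {}"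
    and B: "finite B" "normal_subset G B"
    and le: "real (card (A <#> B)) \<le> K * real (card A)"
  obtains X where "X \<subseteq> A" "X \<noteq> {}"
    "\<And>m. real (card (X <#> set_power G B m)) \<le> K ^ m * real (card X)"
proof -
  define r where "r = (\<lambda>Z. real (card (Z <#> B)) / real (card Z))"
  have BG: "B \<subseteq> carrier G" using B by (simp add: normal_subset_def)
  have card_pos: "0 < real (card Z)" if "Z \<subseteq> A" "Z \<noteq> {}" for Z
    using that A finite_subset card_gt_0_iff by (metis of_nat_0_less_iff)
  \<comment> \<open>The empty set must be left out: with \<open>0 / 0 = 0\<close> its ratio would be
    0 and it could be the minimiser.\<close>
  have "finite (Pow A - {{}})" "Pow A - {{}} \<noteq> {}"
    using A by auto
  then obtain X where X: "X \<in> Pow A - {{}}" and X_min: "\<And>Z. Z \<in> Pow A - {{}} \<Longrightarrow> r X \<le> r Z"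
    using arg_min_if_finite[of "Pow A - {{}}" r] by (metis not_less)
  then have XA: "X \<subseteq> A" "X \<noteq> {}" by auto
  then have XG: "X \<subseteq> carrier G" "finite X" using A finite_subset by blast+
  \<comment> \<open>\<open>A\<close> is itself a competitor, so the minimal ratio is at most
    \<open>K\<close>.\<close>
  have "r X \<le> r A" using X_min A by simp
  also have "\<dots> \<le> K"
    using le card_pos[OF order_refl A(3)] by (simp add: r_def divide_le_eq)
  finally have "r X \<le> K" .
  have eq: "real (card (X <#> B)) = r X * real (card X)"
    using card_pos[OF XA] by (simp add: r_def)
  have minimal: "r X * real (card Z) \<le> real (card (Z <#> B))" if "Z \<subseteq> X" for Z
  proof (cases "Z = {}")
    case False
    then have "Z \<subseteq> A" using that XA by blast
    then show ?thesis
      using X_min[of Z] card_pos[of Z] False by (simp add: r_def pos_le_divide_eq)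
  qed simp
  have "real (card (X <#> set_power G B m)) \<le> K ^ m * real (card X)" for m
  proof (induction m)
    case 0
    then show ?case by (simp add: set_mult_one_right XG)
  next
    case (Suc m)
    let ?P = "set_power G B m"
    note P = set_power_subset_carrier[OF BG, of m]
    \<comment> \<open>Moving \<open>B^m\<close> to the left of \<open>X\<close> leaves a single
      \<open>B\<close> on the right, the shape to which \<open>petridis\<close> applies with
      \<open>C = B^m\<close>.\<close>
    have "X <#> set_power G B (Suc m) = ?P <#> X <#> B"
      using set_mult_assoc[OF XG(1) P BG] set_power_commute[OF B(2) XG(1)] by simp
    then have "real (card (X <#> set_power G B (Suc m))) \<le> r X * real (card (?P <#> X))"
      using petridis[OF XG BG B(1) eq minimal finite_set_power[OF B(1)] P] by simp
    also have "\<dots> \<le> K * real (card (X <#> ?P))"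
      using \<open>r X \<le> K\<close> set_power_commute[OF B(2) XG(1)] by (simp add: mult_right_mono)
    also have "\<dots> \<le> K * (K ^ m * real (card X))"
    proof -
      \<comment> \<open>Multiplying the induction hypothesis by \<open>K\<close> requires
        \<open>K\<close> to be nonnegative, which follows from
        \<open>0 \<le> r X \<le> K\<close>.\<close>
      have "0 \<le> r X" by (simp add: r_def)
      then show ?thesis using \<open>r X \<le> K\<close> Suc by (intro mult_left_mono) auto
    qed
    finally show ?case by (simp add: mult.assoc)
  qed
  then show ?thesis using that XA by blast
qed

text \<open>Take \<open>A = B\<close> in the previous result. Passing from \<open>X <#> B^m\<close>
  to \<open>B^m\<close> does not increase the left side, and replacing \<open>X\<close> by the
  larger \<open>B\<close> does not decrease the right side.\<close>

lemma (in group) card_set_power_le: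
  fixes K :: real
  assumes B: "finite B" "normal_subset G B" and "0 < K" "1 \<le> m"
    and le: "real (card (set_power G B 2)) \<le> K * real (card B)"
  shows "real (card (set_power G B m)) \<le> K ^ m * real (card B)"
proof (cases "B = {}")
  case True
  \<comment> \<open>Here \<open>m = 0\<close> would fail: the power is then \<open>{\<one>}\<close>,
    of size 1, while the bound is 0.\<close>
  then show ?thesis using \<open>1 \<le> m\<close> by (cases m) (simp_all add: set_mult_def)
next
  case False
  have BG: "B \<subseteq> carrier G" using B by (simp add: normal_subset_def)
  have "set_power G B 2 = B <#> B"
    by (simp add: numeral_2_eq_2 set_mult_one_left BG)
  then obtain X where X: "X \<subseteq> B" "X \<noteq> {}"
    and bound: "\<And>m. real (card (X <#> set_power G B m)) \<le> K ^ m * real (card X)"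
    using pluennecke_normal_subset[OF BG B(1) False B] le by metis
  have "card (set_power G B m) \<le> card (X <#> set_power G B m)"
    using X BG B finite_subset[OF X(1) B(1)]
    by (intro card_set_mult_ge_right set_power_subset_carrier finite_set_power) auto
  then have "real (card (set_power G B m)) \<le> K ^ m * real (card X)"
    using bound[of m] by linarith
  also have "\<dots> \<le> K ^ m * real (card B)"
    using card_mono[OF B(1) X(1)] \<open>0 < K\<close> by simp
  finally show ?thesis .
qed

theorem theorem4p3:
  fixes G :: "('a, 'b) monoid_scheme"
  assumes "group G"
  shows "(\<forall>A B. \<forall>K::real.
            A \<subseteq> carrier G \<and> finite A \<and> A \<noteq> {} \<and> finite B \<and> normal_subset G B \<and>
            K > 0 \<and> real (card (A <#>\<^bsub>G\<^esub> B)) \<le> K * real (card A) \<longrightarrow>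
            (\<exists>X. X \<subseteq> A \<and> X \<noteq> {} \<and>
              (\<forall>m\<ge>1. real (card (X <#>\<^bsub>G\<^esub> set_power G B m)) \<le> K ^ m * real (card X)))) \<and>
         (\<forall>B. \<forall>K::real.
            finite B \<and> normal_subset G B \<and>
            K > 0 \<and> real (card (set_power G B 2)) \<le> K * real (card B) \<longrightarrow>
            (\<forall>m\<ge>1. real (card (set_power G B m)) \<le> K ^ m * real (card B)))"
proof -
  interpret group G by fact
  show ?thesis
  proof (intro conjI allI impI; elim conjE)
    fix A B :: "'a set" and K :: real
    assume "A \<subseteq> carrier G" "finite A" "A \<noteq> {}" "finite B" "normal_subset G B"
      "real (card (A <#>\<^bsub>G\<^esub> B)) \<le> K * real (card A)"
    then show "\<exists>X. X \<subseteq> A \<and> X \<noteq> {} \<and>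
        (\<forall>m\<ge>1. real (card (X <#>\<^bsub>G\<^esub> set_power G B m)) \<le> K ^ m * real (card X))"
      by (rule pluennecke_normal_subset) blast
  qed (rule card_set_power_le)
qed

end
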